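(* Let $p=p(\theta)\geq 0$ and $t=t(\theta)$ be $C^1$-functions defined on $\theta\in[0,2\pi]$ satisfying $$t'=(p')^2-p^2 .$$ Then there exists a horizontally regular curve $\gamma$ in the Heisenberg group $\mathbb{H}_1$, parametrized by (horizontal) arc-length, such that $\gamma$ is the horizontal envelope of the family of horizontal lines $\{\ell(p(\theta),\theta,t(\theta)) : \theta\in[0,2\pi]\}$. In coordinates, the envelope $\gamma=(x,y,z)$ can be represented by $$x(\theta)=p(\theta)\cos\theta-p'(\theta)\sin\theta,\qquad y(\theta)=p(\theta)\sin\theta+p'(\theta)\cos\theta,\qquad z(\theta)=t(\theta)-p'(\theta)p(\theta).$$ Moreover, if $p$ is a $C^2$-function, the $p$-curvature and the contact normality of $\gamma$ are given by $k=\frac{1}{p+p''}$ and $\tau\equiv 0$.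
   Context: The 3-dimensional Heisenberg group $\mathbb{H}_1$ is $\mathbb{R}^3$ with the group law $(x,y,z)\star(x',y',z')=(x+x',y+y',z+z'+yx'-xy')$. Left invariant vector fields are $\mathring{e}_1=\partial_x+y\,\partial_z$, $\mathring{e}_2=\partial_y-x\,\partial_z$, $T=\partial_z$, and $\langle\cdot,\cdot\rangle$ is the left invariant Riemannian metric making them orthonormal. The contact plane $\xi_q$ at a point $q$ is the span of $\mathring{e}_1(q),\mathring{e}_2(q)$. $J$ is the endomorphism with $J\mathring{e}_1=\mathring{e}_2$, $J\mathring{e}_2=-\mathring{e}_1$, $JT=0$. A curve $\gamma=(x,y,z)$ is horizontal if its tangent vector lies in the contact plane at each of its points, equivalently $z'-x'y+xy'=0$. Write $\gamma'=\gamma'_\xi+\gamma'_T$ for the orthogonal decomposition of the velocity along $\xi$ and $T$. A curve is horizontally regular if $\gamma'_\xi\neq 0$ everywhere; it is parametrized by horizontal arc-length $s$ if $|\gamma'_\xi(s)|=1$ for all $s$. For a horizontally regular curve parametrized by horizontal arc-length, the $p$-curvature is $k(s)=\langle \frac{d\gamma'(s)}{ds},J\gamma'(s)\rangle$ and the contact normality is $\tau(s)=\langle\gamma'(s),T\rangle$. In an arbitrary parameter $u$, the $p$-curvature is given by $k(u)=\frac{x'y''-x''y'}{((x')^2+(y')^2)^{3/2}}(u)$. For $p\ge 0$, $\theta\in[0,2\pi]$, $t\in\mathbb{R}$, the horizontal line $\ell(p,\theta,t)$ is the set of points $(p\cos\theta-s\sin\theta,\ p\sin\theta+s\cos\theta,\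 t-sp)$, $s\in\mathbb{R}$. Given a family of horizontal lines in $\mathbb{H}_1$, a horizontal envelope is a horizontal curve $\gamma$ (tangent to the lines of the family) such that $\gamma$ contacts with exactly one line in the family at one point. Primes on $p,t$ denote derivatives with respect to $\theta$.
   Formalization: Added hypothesis: p'(θ)+∫_0^θ p is strictly increasing on [0,2π] (for C² p, p+p''≠0 everywhere suffices); without it the claim fails, e.g. p=0, t constant gives a single point. The curvature formula is asserted where p+p''≠0. *)

theory Defs
  imports "HOL-Analysis.Analysis"
begin

type_synonym heis = "real \<times> real \<times> real"

fun heis_mult :: "heis \<Rightarrow> heis \<Rightarrow> heis" where
  "heis_mult (x, y, z) (x', y', z') = (x + x', y + y', z + z' + y * x' - x * y')"

fun heis_e1 :: "heis \<Rightarrow> heis" where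
  "heis_e1 (x, y, z) = (1, 0, y)"

fun heis_e2 :: "heis \<Rightarrow> heis" where
  "heis_e2 (x, y, z) = (0, 1, - x)"

definition heis_T :: "heis \<Rightarrow> heis" where
  "heis_T q = (0, 0, 1)"

lemma frame_left_invariant:
  "((\<lambda>r. heis_mult a (q + r *\<^sub>R heis_e1 q)) has_vector_derivative heis_e1 (heis_mult a q)) (at 0)"
  "((\<lambda>r. heis_mult a (q + r *\<^sub>R heis_e2 q)) has_vector_derivative heis_e2 (heis_mult a q)) (at 0)"
  "((\<lambda>r. heis_mult a (q + r *\<^sub>R heis_T q)) has_vector_derivative heis_T (heis_mult a q)) (at 0)"
  by (cases a; cases q; auto simp: heis_T_def algebra_simps intro!: derivative_eq_intros)+

text \<open>A vector \<open>v = (v1, v2, v3)\<close> at \<open>q = (x, y, z)\<close> is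
  \<open>v1 heis_e1 + v2 heis_e2 + (v3 - y v1 + x v2) heis_T\<close>.\<close>

fun T_coeff :: "heis \<Rightarrow> heis \<Rightarrow> real" where
  "T_coeff (x, y, z) (v1, v2, v3) = v3 - y * v1 + x * v2"

lemma frame_decomposition:
  "v = fst v *\<^sub>R heis_e1 q + fst (snd v) *\<^sub>R heis_e2 q + T_coeff q v *\<^sub>R heis_T q"
  by (cases q; cases v) (simp add: heis_T_def algebra_simps)

definition heis_inner :: "heis \<Rightarrow> heis \<Rightarrow> heis \<Rightarrow> real" where
  "heis_inner q u v = fst u * fst v + fst (snd u) * fst (snd v) + T_coeff q u * T_coeff q v"

lemma heis_frame_orthonormal:
  "heis_inner q (heis_e1 q) (heis_e1 q) = 1" "heis_inner q (heis_e2 q) (heis_e2 q) = 1"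
  "heis_inner q (heis_T q) (heis_T q) = 1" "heis_inner q (heis_e1 q) (heis_e2 q) = 0"
  "heis_inner q (heis_e1 q) (heis_T q) = 0" "heis_inner q (heis_e2 q) (heis_T q) = 0"
  by (cases q; simp add: heis_inner_def heis_T_def)+

definition heis_norm :: "heis \<Rightarrow> heis \<Rightarrow> real" where
  "heis_norm q v = sqrt (heis_inner q v v)"

definition contact_plane :: "heis \<Rightarrow> heis set" where
  "contact_plane q = span {heis_e1 q, heis_e2 q}"

definition contact_part :: "heis \<Rightarrow> heis \<Rightarrow> heis" where
  "contact_part q v = heis_inner q v (heis_e1 q) *\<^sub>R heis_e1 q + heis_inner q v (heis_e2 q) *\<^sub>R heis_e2 q"

definition heis_J :: "heis \<Rightarrow> heis \<Rightarrow> heis" where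
  "heis_J q v = heis_inner q v (heis_e1 q) *\<^sub>R heis_e2 q - heis_inner q v (heis_e2 q) *\<^sub>R heis_e1 q"

text \<open>Curves live on a compact interval \<open>S\<close>; derivatives are one-sided at its end points.\<close>

definition velocity :: "(real \<Rightarrow> heis) \<Rightarrow> real set \<Rightarrow> real \<Rightarrow> heis" where
  "velocity \<gamma> S s = vector_derivative \<gamma> (at s within S)"

definition C1_curve :: "(real \<Rightarrow> heis) \<Rightarrow> real set \<Rightarrow> bool" where
  "C1_curve \<gamma> S \<longleftrightarrow> \<gamma> differentiable_on S \<and> continuous_on S (velocity \<gamma> S)"

definition horizontal_curve :: "(real \<Rightarrow> heis) \<Rightarrow> real set \<Rightarrow> bool" where
  "horizontal_curve \<gamma> S \<longleftrightarrow>
     C1_curve \<gamma> S \<and> (\<forall>s\<in>S. velocity \<gamma> S s \<in> contact_plane (\<gamma> s))"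

definition horizontally_regular :: "(real \<Rightarrow> heis) \<Rightarrow> real set \<Rightarrow> bool" where
  "horizontally_regular \<gamma> S \<longleftrightarrow>
     C1_curve \<gamma> S \<and> (\<forall>s\<in>S. contact_part (\<gamma> s) (velocity \<gamma> S s) \<noteq> 0)"

definition horizontal_arclength_param :: "(real \<Rightarrow> heis) \<Rightarrow> real set \<Rightarrow> bool" where
  "horizontal_arclength_param \<gamma> S \<longleftrightarrow>
     C1_curve \<gamma> S \<and> (\<forall>s\<in>S. heis_norm (\<gamma> s) (contact_part (\<gamma> s) (velocity \<gamma> S s)) = 1)"

text \<open>For a curve parametrized by horizontal arc-length. The acceleration may be taken
  componentwise in the coordinates: only its \<open>heis_e1\<close> and \<open>heis_e2\<close> components enter. The relation
  includes the existence of the acceleration at \<open>s\<close>.\<close>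

definition has_p_curvature :: "(real \<Rightarrow> heis) \<Rightarrow> real set \<Rightarrow> real \<Rightarrow> real \<Rightarrow> bool" where
  "has_p_curvature \<gamma> S k s \<longleftrightarrow>
     (\<exists>a. (velocity \<gamma> S has_vector_derivative a) (at s within S) \<and>
          k = heis_inner (\<gamma> s) a (heis_J (\<gamma> s) (velocity \<gamma> S s)))"

definition contact_normality :: "(real \<Rightarrow> heis) \<Rightarrow> real set \<Rightarrow> real \<Rightarrow> real" where
  "contact_normality \<gamma> S s = heis_inner (\<gamma> s) (velocity \<gamma> S s) (heis_T (\<gamma> s))"

definition horizontal_line :: "real \<Rightarrow> real \<Rightarrow> real \<Rightarrow> heis set" where
  "horizontal_line p \<theta> t =
     {(p * cos \<theta> - s * sin \<theta>, p * sin \<theta> + s * cos \<theta>, t - s * p) | s. True}"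

text \<open>Contact of \<open>\<gamma>\<close> with a straight line \<open>L\<close>: \<open>\<gamma> s\<close> lies on \<open>L\<close> and the (nonzero) velocity
  there is a direction vector of \<open>L\<close>.\<close>

definition contacts :: "(real \<Rightarrow> heis) \<Rightarrow> real set \<Rightarrow> real \<Rightarrow> heis set \<Rightarrow> bool" where
  "contacts \<gamma> S s L \<longleftrightarrow>
     \<gamma> s \<in> L \<and> velocity \<gamma> S s \<noteq> 0 \<and> (\<forall>r. \<gamma> s + r *\<^sub>R velocity \<gamma> S s \<in> L)"

text \<open>Lines of the family are compared as subsets of the Heisenberg group. A line may be touched
  twice: \<open>\<theta> = 0\<close> and \<open>\<theta> = 2 pi\<close> can give the same line with different contact points.\<close>

definition horizontal_envelope :: "(real \<Rightarrow> heis) \<Rightarrow> real set \<Rightarrow> heis set set \<Rightarrow> bool" where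
  "horizontal_envelope \<gamma> S F \<longleftrightarrow>
     horizontal_curve \<gamma> S \<and>
     (\<forall>L\<in>F. \<exists>s\<in>S. contacts \<gamma> S s L) \<and>
     (\<forall>s\<in>S. \<exists>!L. L \<in> F \<and> contacts \<gamma> S s L)"

definition has_C1_deriv_on :: "(real \<Rightarrow> real) \<Rightarrow> (real \<Rightarrow> real) \<Rightarrow> real set \<Rightarrow> bool" where
  "has_C1_deriv_on f f' S \<longleftrightarrow>
     (\<forall>x\<in>S. (f has_real_derivative f' x) (at x within S)) \<and> continuous_on S f'"

text \<open>The points \<open>(p cos \<theta> - p' sin \<theta>, p sin \<theta> + p' cos \<theta>)\<close> form a regular curve only if the radius
  of curvature \<open>p + p''\<close> does not degenerate (for \<open>p = 0\<close> they reduce to a single point). When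
  \<open>p\<close> is merely \<open>C\<^sup>1\<close>, this is expressed through the primitive
  \<open>\<theta> \<mapsto> p' \<theta> + integral {0..\<theta>} p\<close> of \<open>p + p''\<close>, which measures arc-length: it must be
  strictly increasing. For \<open>p \<ge> 0\<close> of class \<open>C\<^sup>2\<close> it suffices that \<open>p + p'' \<noteq> 0\<close>.\<close>

definition nondegenerate_support :: "(real \<Rightarrow> real) \<Rightarrow> (real \<Rightarrow> real) \<Rightarrow> bool" where
  "nondegenerate_support p p' \<longleftrightarrow>
     strict_mono_on {0..2*pi} (\<lambda>\<theta>. p' \<theta> + integral {0..\<theta>} p)"

lemma nondegenerate_support_C2:
  assumes p: "has_C1_deriv_on p p' {0..2*pi}" and p': "has_C1_deriv_on p' p'' {0..2*pi}"
    and nonneg: "\<And>\<theta>. \<theta> \<in> {0..2*pi} \<Longrightarrow> p \<theta> \<ge> 0"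
    and nz: "\<And>\<theta>. \<theta> \<in> {0..2*pi} \<Longrightarrow> p \<theta> + p'' \<theta> \<noteq> 0"
  shows "nondegenerate_support p p'"
proof -
  let ?I = "{0..2*pi}" and ?f = "\<lambda>\<theta>. p \<theta> + p'' \<theta>"
  have dp: "(p has_real_derivative p' x) (at x within ?I)"
    and dp': "(p' has_real_derivative p'' x) (at x within ?I)" if "x \<in> ?I" for x
    using p p' that by (auto simp: has_C1_deriv_on_def)
  have cp: "continuous_on ?I p"
    by (rule DERIV_continuous_on) (rule dp)
  have cf: "continuous_on ?I ?f"
    using cp p' by (auto simp: has_C1_deriv_on_def intro: continuous_intros)
  have cp': "continuous_on ?I p'"
    using p by (auto simp: has_C1_deriv_on_def)
  have conn: "connected (?f ` ?I)"
    using cf by (intro connected_continuous_image) auto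
  have sgn: "(\<forall>x\<in>?I. ?f x > 0) \<or> (\<forall>x\<in>?I. ?f x < 0)"
  proof (rule ccontr)
    assume "\<not> ?thesis"
    then obtain x y where "x \<in> ?I" "y \<in> ?I" "?f x \<le> 0" "0 \<le> ?f y"
      by (meson linorder_not_le)
    then have "0 \<in> ?f ` ?I"
      using connectedD_interval[OF conn, of "?f x" "?f y" 0] by blast
    then show False using nz by (metis (no_types, lifting) imageE)
  qed
  have pos: "?f x > 0" if "x \<in> ?I" for x
  proof (rule ccontr)
    assume "\<not> ?f x > 0"
    with sgn that have neg: "\<And>x. x \<in> ?I \<Longrightarrow> ?f x < 0" by blast
    let ?g = "\<lambda>\<theta>. p' \<theta> * sin \<theta> - p \<theta> * cos \<theta>"
    have "?g pi < ?g 0"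
    proof (rule DERIV_neg_imp_decreasing_open[where f = ?g])
      show "\<exists>y. (?g has_real_derivative y) (at x) \<and> y < 0" if "0 < x" "x < pi" for x
      proof (intro exI conjI)
        have x: "x \<in> ?I" and i: "x \<in> interior ?I" using that by auto
        have "(p has_real_derivative p' x) (at x)" "(p' has_real_derivative p'' x) (at x)"
          using dp[OF x] dp'[OF x] at_within_interior[OF i] by simp_all
        then show "(?g has_real_derivative (?f x) * sin x) (at x)"
          by (auto intro!: derivative_eq_intros simp: algebra_simps)
        show "(?f x) * sin x < 0"
          using neg[OF x] sin_gt_zero[OF that] by (simp add: mult_neg_pos)
      qed
      show "continuous_on {0..pi} ?g"
        by (intro continuous_intros continuous_on_subset[OF cp] continuous_on_subset[OF cp']) auto
    qed simp
    then show False using nonneg[of pi] nonneg[of 0] by simp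
  qed
  show ?thesis
    unfolding nondegenerate_support_def
  proof (intro strict_mono_onI)
    let ?R = "\<lambda>\<theta>. p' \<theta> + integral {0..\<theta>} p"
    fix a b :: real assume ab: "a \<in> ?I" "b \<in> ?I" "a < b"
    have dR: "(?R has_real_derivative p'' x + p x) (at x within ?I)" if "x \<in> ?I" for x
      using dp'[OF that] integral_has_real_derivative[OF cp that]
      by (intro DERIV_add) auto
    show "?R a < ?R b"
    proof (rule DERIV_pos_imp_increasing_open[OF \<open>a < b\<close>, where f = ?R])
      show "\<exists>y. (?R has_real_derivative y) (at x) \<and> y > 0" if "a < x" "x < b" for x
      proof (intro exI conjI)
        have x: "x \<in> ?I" and i: "x \<in> interior ?I" using that ab by auto
        show "(?R has_real_derivative p'' x + p x) (at x)"
          using dR[OF x] at_within_interior[OF i] by simp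
        show "p'' x + p x > 0" using pos[OF x] by simp
      qed
      have "continuous_on ?I ?R" by (rule DERIV_continuous_on) (rule dR)
      then show "continuous_on {a..b} ?R"
        using ab by (auto intro: continuous_on_subset)
    qed
  qed
qed

end

theory Submission
  imports Defs
begin

text \<open>The arc-length of the envelope is \<open>\<sigma> \<theta> = p' \<theta> + Q \<theta>\<close>, where \<open>Q\<close> is a primitive of \<open>p\<close>,
  and the coordinates \<open>x, y, z\<close> of the envelope should satisfy \<open>dx = - sin \<theta> d\<sigma>\<close>, \<open>dy = cos \<theta> d\<sigma>\<close>,
  \<open>dz = - p d\<sigma>\<close>. As \<open>p'\<close> need not be differentiable, these are Stieltjes differentials. Integrating by
  parts, \<open>df = - g d\<sigma>\<close> is read as \<open>d(f + \<sigma> g) = \<sigma> g' d\<theta>\<close>, in which everything is differentiable;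
  for \<open>z\<close> this is the equation \<open>t' = p'\<^sup>2 - p\<^sup>2\<close>. Monotonicity of \<open>\<sigma>\<close> then makes \<open>f\<close> differentiable
  as a function of \<open>\<sigma>\<close>, with derivative \<open>- g\<close>.\<close>

lemma has_real_derivative_reparam:
  fixes f g g' \<sigma> \<phi> :: "real \<Rightarrow> real"
  assumes mono: "mono_on {a..b} \<sigma>"
    and fg: "\<And>u. u \<in> {a..b} \<Longrightarrow>
      ((\<lambda>u. f u + \<sigma> u * g u) has_real_derivative \<sigma> u * g' u) (at u within {a..b})"
    and g: "\<And>u. u \<in> {a..b} \<Longrightarrow> (g has_real_derivative g' u) (at u within {a..b})"
    and g': "continuous_on {a..b} g'"
    and \<phi>: "continuous_on S \<phi>" "\<And>s. s \<in> S \<Longrightarrow> \<phi> s \<in> {a..b}" "\<And>s. s \<in> S \<Longrightarrow> \<sigma> (\<phi> s) = s"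
    and s: "s \<in> S"
  shows "((\<lambda>s. f (\<phi> s)) has_real_derivative - g (\<phi> s)) (at s within S)"
proof -
  obtain M where M: "\<And>u. u \<in> {a..b} \<Longrightarrow> \<bar>g' u\<bar> \<le> M"
    using compact_imp_bounded[OF compact_continuous_image[OF g' compact_Icc]]
    by (force simp: bounded_iff)
  \<comment> \<open>The mean value inequality for \<open>?h\<close>: with \<open>\<sigma> u\<close>
    frozen, its derivative is \<open>(\<sigma> w - \<sigma> u) * g' w\<close>, and monotonicity
    bounds the first factor by \<open>\<bar>\<sigma> v - \<sigma> u\<bar>\<close> between
    \<open>u\<close> and \<open>v\<close>. After division by \<open>\<sigma> v - \<sigma> u\<close>,
    the factor \<open>\<bar>v - u\<bar>\<close> remains and tends to 0.\<close>
  have bound: "\<bar>f v - f u + (\<sigma> v - \<sigma> u) * g v\<bar> \<le> M * \<bar>\<sigma> v - \<sigma> u\<bar> * \<bar>v - u\<bar>"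
    if u: "u \<in> {a..b}" and v: "v \<in> {a..b}" for u v
  proof -
    let ?K = "closed_segment u v" and ?h = "\<lambda>w. f w + \<sigma> w * g w - \<sigma> u * g w"
    have K: "?K \<subseteq> {a..b}"
      using u v by (simp add: closed_segment_subset)
    have "norm (?h v - ?h u) \<le> (M * \<bar>\<sigma> v - \<sigma> u\<bar>) * norm (v - u)"
    proof (rule field_differentiable_bound)
      fix w assume "w \<in> ?K"
      then have w: "w \<in> {a..b}" using K by blast
      show "(?h has_field_derivative \<sigma> w * g' w - \<sigma> u * g' w) (at w within ?K)"
        by (intro DERIV_subset[OF _ K] DERIV_diff fg DERIV_cmult g w)
      have "\<bar>\<sigma> w - \<sigma> u\<bar> \<le> \<bar>\<sigma> v - \<sigma> u\<bar>"
        using \<open>w \<in> ?K\<close> mono_onD[OF mono u w] mono_onD[OF mono w v]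
          mono_onD[OF mono w u] mono_onD[OF mono v w]
        by (auto simp: closed_segment_eq_real_ivl split: if_splits)
      then have "\<bar>g' w\<bar> * \<bar>\<sigma> w - \<sigma> u\<bar> \<le> M * \<bar>\<sigma> v - \<sigma> u\<bar>"
        using M[OF w] by (intro mult_mono) auto
      then show "norm (\<sigma> w * g' w - \<sigma> u * g' w) \<le> M * \<bar>\<sigma> v - \<sigma> u\<bar>"
        by (simp add: abs_mult[symmetric] algebra_simps)
    qed auto
    then show ?thesis by (simp add: algebra_simps)
  qed
  have \<phi>_lim: "(\<phi> \<longlongrightarrow> \<phi> s) (at s within S)"
    using \<phi>(1) s by (simp add: continuous_on_def)
  have "continuous_on {a..b} g"
    by (rule DERIV_continuous_on) (rule g)
  then have "continuous_on S (\<lambda>s. g (\<phi> s))"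
    using \<phi> by (intro continuous_on_compose2[of "{a..b}" g S \<phi>]) auto
  then have g_lim: "((\<lambda>r. g (\<phi> r)) \<longlongrightarrow> g (\<phi> s)) (at s within S)"
    using s by (simp add: continuous_on_def)
  \<comment> \<open>Since \<open>bound\<close> evaluates \<open>g\<close> at the moving end, the
    quotient is first compared with \<open>g (\<phi> r)\<close>; continuity of \<open>g\<close> and
    \<open>\<phi>\<close> then gives the limit \<open>- g (\<phi> s)\<close>.\<close>
  let ?q = "\<lambda>r. (f (\<phi> r) - f (\<phi> s)) / (r - s)"
  have "((\<lambda>r. ?q r + g (\<phi> r)) \<longlongrightarrow> 0) (at s within S)"
  proof (rule Lim_null_comparison)
    have "norm (?q r + g (\<phi> r)) \<le> M * \<bar>\<phi> r - \<phi> s\<bar>" if "r \<in> S" "r \<noteq> s" for r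
    proof -
      have "\<bar>f (\<phi> r) - f (\<phi> s) + (r - s) * g (\<phi> r)\<bar> \<le> M * \<bar>r - s\<bar> * \<bar>\<phi> r - \<phi> s\<bar>"
        using bound[of "\<phi> s" "\<phi> r"] \<phi> s that by simp
      moreover have "?q r + g (\<phi> r) = (f (\<phi> r) - f (\<phi> s) + (r - s) * g (\<phi> r)) / (r - s)"
        using that by (simp add: field_simps)
      ultimately show ?thesis
        using that by (simp add: abs_divide pos_divide_le_eq mult.commute mult.left_commute)
    qed
    then show "\<forall>\<^sub>F r in at s within S. norm (?q r + g (\<phi> r)) \<le> M * \<bar>\<phi> r - \<phi> s\<bar>"
      by (auto simp: eventually_at intro!: exI[of _ 1])
    have "((\<lambda>r. M * \<bar>\<phi> r - \<phi> s\<bar>) \<longlongrightarrow> M * \<bar>\<phi> s - \<phi> s\<bar>) (at s within S)"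
      by (intro tendsto_intros \<phi>_lim)
    then show "((\<lambda>r. M * \<bar>\<phi> r - \<phi> s\<bar>) \<longlongrightarrow> 0) (at s within S)" by simp
  qed
  from tendsto_diff[OF this g_lim] show ?thesis
    by (simp add: has_field_derivative_iff)
qed

text \<open>Along \<open>\<phi>\<close> the difference quotients of \<open>\<sigma>\<close> are the
  reciprocals of those of \<open>\<phi>\<close>, with no division by zero because
  \<open>\<sigma>\<close> undoes \<open>\<phi>\<close>, which is therefore injective. All limits are
  relative to \<open>S\<close> and \<open>T\<close>, so end points of intervals are covered.\<close>

lemma has_real_derivative_right_inverse:
  fixes \<sigma> \<phi> :: "real \<Rightarrow> real"
  assumes \<sigma>: "(\<sigma> has_real_derivative d) (at (\<phi> s) within T)" and d: "d \<noteq> 0"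
    and \<phi>: "continuous_on S \<phi>" "\<phi> ` S \<subseteq> T" "\<And>s. s \<in> S \<Longrightarrow> \<sigma> (\<phi> s) = s"
    and s: "s \<in> S"
  shows "(\<phi> has_real_derivative 1 / d) (at s within S)"
proof -
  have lim: "filterlim \<phi> (at (\<phi> s) within T) (at s within S)"
    unfolding filterlim_at
  proof
    have "r \<in> S \<Longrightarrow> r \<noteq> s \<Longrightarrow> \<phi> r \<in> T \<and> \<phi> r \<noteq> \<phi> s" for r
      using \<phi>(2,3) s by (metis image_subset_iff)
    then show "\<forall>\<^sub>F r in at s within S. \<phi> r \<in> T \<and> \<phi> r \<noteq> \<phi> s"
      by (auto simp: eventually_at intro!: exI[of _ 1])
    show "(\<phi> \<longlongrightarrow> \<phi> s) (at s within S)"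
      using \<phi>(1) s by (simp add: continuous_on_def)
  qed
  have "((\<lambda>r. inverse ((\<sigma> (\<phi> r) - \<sigma> (\<phi> s)) / (\<phi> r - \<phi> s))) \<longlongrightarrow> inverse d) (at s within S)"
    using filterlim_compose[OF \<sigma>[unfolded has_field_derivative_iff] lim] d
    by (intro tendsto_inverse) auto
  then have "((\<lambda>r. (\<phi> r - \<phi> s) / (r - s)) \<longlongrightarrow> inverse d) (at s within S)"
    by (rule Lim_transform_eventually)
      (use \<phi>(3) s in \<open>auto simp: eventually_at intro!: exI[of _ 1]\<close>)
  then show ?thesis
    by (simp add: has_field_derivative_iff inverse_eq_divide)
qed

text \<open>The intermediate value theorem identifies the image, and compactness of the domain makes
  the inverse continuous.\<close>

lemma strict_mono_homeomorphism:
  fixes \<sigma> :: "real \<Rightarrow> real"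
  assumes "a \<le> b" "continuous_on {a..b} \<sigma>" "strict_mono_on {a..b} \<sigma>"
  obtains \<phi> where "homeomorphism {a..b} {\<sigma> a..\<sigma> b} \<sigma> \<phi>"
proof -
  have "\<sigma> ` {a..b} = {\<sigma> a..\<sigma> b}"
  proof
    show "\<sigma> ` {a..b} \<subseteq> {\<sigma> a..\<sigma> b}"
      using strict_mono_on_leD[OF assms(3)] assms(1) by auto
    show "{\<sigma> a..\<sigma> b} \<subseteq> \<sigma> ` {a..b}"
      using IVT'[of \<sigma> a _ b] assms by (force simp: image_iff)
  qed
  then show ?thesis
    using homeomorphism_compact[OF compact_Icc assms(2)] strict_mono_on_imp_inj_on[OF assms(3)] that
    by blast
qed

lemma has_vector_derivative_heis:
  assumes "(f has_real_derivative f') (at s within S)"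
    and "(g has_real_derivative g') (at s within S)"
    and "(h has_real_derivative h') (at s within S)"
  shows "((\<lambda>s. (f s, g s, h s)) has_vector_derivative (f', g', h')) (at s within S)"
  using assms by (intro has_vector_derivative_Pair)
    (simp_all add: has_real_derivative_iff_has_vector_derivative)

text \<open>On a nondegenerate interval one-sided derivatives at the end points are unique as well,
  so the value chosen by \<open>vector_derivative\<close> must be \<open>v\<close>.\<close>

lemma C1_curveI:
  assumes "a < b" "\<And>s. s \<in> {a..b} \<Longrightarrow> (\<gamma> has_vector_derivative v s) (at s within {a..b})"
    and "continuous_on {a..b} v"
  shows "C1_curve \<gamma> {a..b}"
    and "s \<in> {a..b} \<Longrightarrow> velocity \<gamma> {a..b} s = v s"
proof -
  have vel: "velocity \<gamma> {a..b} s = v s" if "s \<in> {a..b}" for s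
    using vector_derivative_within_closed_interval[OF assms(1) that assms(2)[OF that]]
    by (simp add: velocity_def)
  then show "s \<in> {a..b} \<Longrightarrow> velocity \<gamma> {a..b} s = v s" .
  show "C1_curve \<gamma> {a..b}"
    unfolding C1_curve_def
  proof
    show "\<gamma> differentiable_on {a..b}"
      using assms(2) by (meson differentiable_on_def differentiableI_vector)
    show "continuous_on {a..b} (velocity \<gamma> {a..b})"
      using assms(3) by (rule continuous_on_eq) (simp add: vel)
  qed
qed

text \<open>Horizontality becomes one linear equation: \<open>T_coeff q\<close> is the third
  coordinate in the frame, and its kernel is spanned by the other two frame vectors.\<close>

lemma contact_plane_iff: "v \<in> contact_plane q \<longleftrightarrow> T_coeff q v = 0"
proof
  assume "v \<in> contact_plane q"
  then show "T_coeff q v = 0"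
    by (cases q) (auto simp: contact_plane_def span_insert span_empty algebra_simps)
next
  assume "T_coeff q v = 0"
  then have "v = fst v *\<^sub>R heis_e1 q + fst (snd v) *\<^sub>R heis_e2 q"
    using frame_decomposition[of v q] by simp
  moreover have "\<dots> \<in> contact_plane q"
    unfolding contact_plane_def by (intro span_add span_scale span_base) auto
  ultimately show "v \<in> contact_plane q" by simp
qed

lemma contact_part_horizontal:
  assumes "T_coeff q v = 0"
  shows "contact_part q v = v"
proof -
  have "heis_inner q v (heis_e1 q) = fst v" "heis_inner q v (heis_e2 q) = fst (snd v)"
    using assms by (cases q; simp add: heis_inner_def)+
  then show ?thesis
    using frame_decomposition[of v q] assms by (simp add: contact_part_def)
qed

lemma horizontal_line_eq:
  "horizontal_line p \<theta> t =
     {(p * cos \<theta>, p * sin \<theta>, t) + r *\<^sub>R (- sin \<theta>, cos \<theta>, - p) | r. True}"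
  by (simp add: horizontal_line_def)

text \<open>A line is determined by one of its points and a nonzero direction: \<open>v\<close> is a
  nonzero multiple \<open>c\<close> of \<open>d\<close>, so the two parametrizations differ by an
  affine change of parameter.\<close>

lemma line_eqI:
  fixes a d q v :: "'a::real_vector"
  assumes L: "L = {a + r *\<^sub>R d | r. True}" and q: "q \<in> L" and qv: "q + v \<in> L" and v: "v \<noteq> 0"
  shows "L = {q + r *\<^sub>R v | r. True}"
proof -
  obtain m n where m: "q = a + m *\<^sub>R d" and n: "q + v = a + n *\<^sub>R d"
    using L q qv by blast
  define c where "c = n - m"
  have vc: "v = c *\<^sub>R d"
    using m n by (simp add: c_def algebra_simps)
  then have c: "c \<noteq> 0" using v by auto
  have "a + r *\<^sub>R d = q + ((r - m) / c) *\<^sub>R v" for r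
  proof -
    have "((r - m) / c) *\<^sub>R v = (r - m) *\<^sub>R d"
      using c by (simp add: vc)
    then show ?thesis by (simp add: m algebra_simps)
  qed
  moreover have "q + r *\<^sub>R v = a + (m + r * c) *\<^sub>R d" for r
    by (simp add: m vc algebra_simps)
  ultimately show ?thesis
    unfolding L by blast
qed

text \<open>A contacted line is the tangent line of the curve, hence depends on \<open>s\<close>
  alone. This gives uniqueness in the definition of the envelope.\<close>

lemma contacts_horizontal_line_eq:
  assumes "contacts \<gamma> S s (horizontal_line p \<theta> t)"
  shows "horizontal_line p \<theta> t = {\<gamma> s + r *\<^sub>R velocity \<gamma> S s | r. True}"
proof (rule line_eqI[OF horizontal_line_eq])
  show "\<gamma> s + velocity \<gamma> S s \<in> horizontal_line p \<theta> t"
    using assms unfolding contacts_def by (metis scaleR_one)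
qed (use assms in \<open>auto simp: contacts_def\<close>)

theorem theorem1:
  fixes p p' t t' :: "real \<Rightarrow> real"
  assumes p_C1: "has_C1_deriv_on p p' {0..2*pi}"
    and t_C1: "has_C1_deriv_on t t' {0..2*pi}"
    and p_nonneg: "\<And>\<theta>. \<theta> \<in> {0..2*pi} \<Longrightarrow> p \<theta> \<ge> 0"
    and t'_eq: "\<And>\<theta>. \<theta> \<in> {0..2*pi} \<Longrightarrow> t' \<theta> = (p' \<theta>)\<^sup>2 - (p \<theta>)\<^sup>2"
    and nondegenerate: "nondegenerate_support p p'"
  shows "\<exists>(l::real) (\<gamma>::real \<Rightarrow> heis) (\<sigma>::real \<Rightarrow> real) (\<phi>::real \<Rightarrow> real).
    l > 0 \<and>
    horizontally_regular \<gamma> {0..l} \<and>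
    horizontal_arclength_param \<gamma> {0..l} \<and>
    horizontal_envelope \<gamma> {0..l} ((\<lambda>\<theta>. horizontal_line (p \<theta>) \<theta> (t \<theta>)) ` {0..2*pi}) \<and>
    homeomorphism {0..2*pi} {0..l} \<sigma> \<phi> \<and>
    (\<forall>\<theta>\<in>{0..2*pi}. \<gamma> (\<sigma> \<theta>) =
       (p \<theta> * cos \<theta> - p' \<theta> * sin \<theta>,
        p \<theta> * sin \<theta> + p' \<theta> * cos \<theta>,
        t \<theta> - p' \<theta> * p \<theta>) \<and>
       contacts \<gamma> {0..l} (\<sigma> \<theta>) (horizontal_line (p \<theta>) \<theta> (t \<theta>))) \<and>
    (\<forall>p''. has_C1_deriv_on p' p'' {0..2*pi} \<longrightarrow>
       (\<forall>\<theta>\<in>{0..2*pi}. p \<theta> + p'' \<theta> \<noteq> 0 \<longrightarrow>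
          has_p_curvature \<gamma> {0..l} (1 / (p \<theta> + p'' \<theta>)) (\<sigma> \<theta>)) \<and>
       (\<forall>s\<in>{0..l}. contact_normality \<gamma> {0..l} s = 0))"
proof -
  let ?I = "{0..2*pi}"
  \<comment> \<open>The constant \<open>p' 0\<close> shifts the primitive of \<open>p\<close> so
    that \<open>\<sigma> 0 = 0\<close>.\<close>
  define Q where "Q \<theta> = integral {0..\<theta>} p - p' 0" for \<theta>
  define \<sigma> where "\<sigma> \<theta> = p' \<theta> + Q \<theta>" for \<theta>
  define l where "l = \<sigma> (2*pi)"
  define x where "x \<theta> = p \<theta> * cos \<theta> - p' \<theta> * sin \<theta>" for \<theta>
  define y where "y \<theta> = p \<theta> * sin \<theta> + p' \<theta> * cos \<theta>" for \<theta>
  define z where "z \<theta> = t \<theta> - p' \<theta> * p \<theta>" for \<theta>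
  let ?L = "\<lambda>\<theta>. horizontal_line (p \<theta>) \<theta> (t \<theta>)"

  \<comment> \<open>The arc-length \<open>\<sigma>\<close> and its inverse
    \<open>\<phi>\<close>\<close>
  have dp: "(p has_real_derivative p' \<theta>) (at \<theta> within ?I)"
    and dt: "(t has_real_derivative (p' \<theta>)\<^sup>2 - (p \<theta>)\<^sup>2) (at \<theta> within ?I)" if "\<theta> \<in> ?I" for \<theta>
    using p_C1 t_C1 t'_eq that by (auto simp: has_C1_deriv_on_def)
  have cp: "continuous_on ?I p"
    by (rule DERIV_continuous_on) (rule dp)
  have cp': "continuous_on ?I p'"
    using p_C1 by (simp add: has_C1_deriv_on_def)
  have dQ: "(Q has_real_derivative p \<theta>) (at \<theta> within ?I)" if "\<theta> \<in> ?I" for \<theta>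
    unfolding Q_def using integral_has_real_derivative[OF cp that]
    by (auto intro!: derivative_eq_intros)
  have c\<sigma>: "continuous_on ?I \<sigma>"
    unfolding \<sigma>_def using cp' DERIV_continuous_on[OF dQ] by (intro continuous_intros)
  have mono: "strict_mono_on ?I \<sigma>"
    using nondegenerate
    by (auto simp: nondegenerate_support_def strict_mono_on_def \<sigma>_def Q_def)
  have \<sigma>0: "\<sigma> 0 = 0"
    by (simp add: \<sigma>_def Q_def)
  have l: "l > 0"
    using strict_mono_onD[OF mono, of 0 "2*pi"] \<sigma>0 by (simp add: l_def)
  obtain \<phi> where hom: "homeomorphism ?I {0..l} \<sigma> \<phi>"
    using strict_mono_homeomorphism[OF _ c\<sigma> mono] \<sigma>0 by (auto simp: l_def)
  have c\<phi>: "continuous_on {0..l} \<phi>" and \<phi>_im: "\<phi> ` {0..l} = ?I" and \<sigma>_im: "\<sigma> ` ?I = {0..l}"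
    using hom by (auto simp: homeomorphism_def)
  have \<phi>_in: "\<phi> s \<in> ?I" and \<sigma>\<phi>: "\<sigma> (\<phi> s) = s" if "s \<in> {0..l}" for s
    using hom that \<phi>_im by (auto simp: homeomorphism_def)
  have \<phi>\<sigma>: "\<phi> (\<sigma> \<theta>) = \<theta>" and \<sigma>_in: "\<sigma> \<theta> \<in> {0..l}" if "\<theta> \<in> ?I" for \<theta>
    using hom that \<sigma>_im by (auto simp: homeomorphism_def)

  \<comment> \<open>The envelope and its velocity in the arc-length parameter\<close>
  define \<gamma> where "\<gamma> s = (x (\<phi> s), y (\<phi> s), z (\<phi> s))" for s
  define v where "v s = (- sin (\<phi> s), cos (\<phi> s), - p (\<phi> s))" for s

  have reparam: "((\<lambda>s. f (\<phi> s)) has_real_derivative - g (\<phi> s)) (at s within {0..l})"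
    if "s \<in> {0..l}"
      and "\<And>\<theta>. \<theta> \<in> ?I \<Longrightarrow>
        ((\<lambda>\<theta>. f \<theta> + \<sigma> \<theta> * g \<theta>) has_real_derivative \<sigma> \<theta> * g' \<theta>) (at \<theta> within ?I)"
      and "\<And>\<theta>. \<theta> \<in> ?I \<Longrightarrow> (g has_real_derivative g' \<theta>) (at \<theta> within ?I)"
      and "continuous_on ?I g'"
    for f g g' s
    using that \<phi>_in \<sigma>\<phi>
    by (intro has_real_derivative_reparam[OF strict_mono_on_imp_mono_on[OF mono] _ _ _ c\<phi>])
  have dx: "((\<lambda>s. x (\<phi> s)) has_real_derivative - sin (\<phi> s)) (at s within {0..l})"
    if s: "s \<in> {0..l}" for s
  proof (rule reparam[where g' = cos, OF s])
    fix \<theta> assume \<theta>: "\<theta> \<in> ?I"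
    \<comment> \<open>The terms containing \<open>p'\<close> cancel, which leaves only the
      differentiable functions \<open>p\<close>, \<open>Q\<close> and \<open>sin\<close>,
      \<open>cos\<close>.\<close>
    have eq: "(\<lambda>\<theta>. x \<theta> + \<sigma> \<theta> * sin \<theta>) = (\<lambda>\<theta>. p \<theta> * cos \<theta> + Q \<theta> * sin \<theta>)"
      by (auto simp: x_def \<sigma>_def algebra_simps)
    show "((\<lambda>\<theta>. x \<theta> + \<sigma> \<theta> * sin \<theta>) has_real_derivative \<sigma> \<theta> * cos \<theta>) (at \<theta> within ?I)"
      unfolding eq by (rule derivative_eq_intros dp[OF \<theta>] dQ[OF \<theta>] refl)+
        (simp add: \<sigma>_def algebra_simps)
  qed (auto intro!: derivative_eq_intros continuous_intros)
  \<comment> \<open>The double minus sign fits \<open>reparam\<close> with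
    \<open>g = - cos\<close>.\<close>
  have dy: "((\<lambda>s. y (\<phi> s)) has_real_derivative - (- cos (\<phi> s))) (at s within {0..l})"
    if s: "s \<in> {0..l}" for s
  proof (rule reparam[where g' = sin, OF s])
    fix \<theta> assume \<theta>: "\<theta> \<in> ?I"
    have eq: "(\<lambda>\<theta>. y \<theta> + \<sigma> \<theta> * (- cos \<theta>)) = (\<lambda>\<theta>. p \<theta> * sin \<theta> - Q \<theta> * cos \<theta>)"
      by (auto simp: y_def \<sigma>_def algebra_simps)
    show "((\<lambda>\<theta>. y \<theta> + \<sigma> \<theta> * (- cos \<theta>)) has_real_derivative \<sigma> \<theta> * sin \<theta>) (at \<theta> within ?I)"
      unfolding eq by (rule derivative_eq_intros dp[OF \<theta>] dQ[OF \<theta>] refl)+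
        (simp add: \<sigma>_def algebra_simps)
  qed (auto intro!: derivative_eq_intros continuous_intros)
  have dz: "((\<lambda>s. z (\<phi> s)) has_real_derivative - p (\<phi> s)) (at s within {0..l})"
    if s: "s \<in> {0..l}" for s
  proof (rule reparam[where g' = p', OF s])
    fix \<theta> assume \<theta>: "\<theta> \<in> ?I"
    \<comment> \<open>Here \<open>p' * p\<close> cancels. The differential equation for
      \<open>t\<close> then turns the derivative of \<open>t + Q * p\<close> into
      \<open>p'\<^sup>2 + Q * p' = \<sigma> * p'\<close>.\<close>
    have eq: "(\<lambda>\<theta>. z \<theta> + \<sigma> \<theta> * p \<theta>) = (\<lambda>\<theta>. t \<theta> + Q \<theta> * p \<theta>)"
      by (auto simp: z_def \<sigma>_def algebra_simps)
    show "((\<lambda>\<theta>. z \<theta> + \<sigma> \<theta> * p \<theta>) has_real_derivative \<sigma> \<theta> * p' \<theta>) (at \<theta> within ?I)"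
      unfolding eq by (rule derivative_eq_intros dp[OF \<theta>] dt[OF \<theta>] dQ[OF \<theta>] refl)+
        (simp add: \<sigma>_def algebra_simps power2_eq_square)
  qed (use dp cp' in auto)

  have d\<gamma>: "(\<gamma> has_vector_derivative v s) (at s within {0..l})" if "s \<in> {0..l}" for s
    unfolding \<gamma>_def v_def using dx[OF that] dy[OF that] dz[OF that]
    by (intro has_vector_derivative_heis) simp_all
  have cv: "continuous_on {0..l} v"
    unfolding v_def using \<phi>_im
    by (intro continuous_intros c\<phi> continuous_on_compose2[OF cp c\<phi>]) auto
  have C1: "C1_curve \<gamma> {0..l}" and vel: "\<And>s. s \<in> {0..l} \<Longrightarrow> velocity \<gamma> {0..l} s = v s"
    using C1_curveI[OF l d\<gamma> cv] by auto

  \<comment> \<open>The terms with \<open>p'\<close> cancel, and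
    \<open>p * (sin\<^sup>2 + cos\<^sup>2)\<close> balances the third component
    \<open>- p\<close>.\<close>
  have T0: "T_coeff (\<gamma> s) (v s) = 0" for s
    using sin_cos_squared_add[of "\<phi> s"] unfolding \<gamma>_def v_def x_def y_def T_coeff.simps by algebra
  have norm1: "heis_norm (\<gamma> s) (v s) = 1" for s
  proof -
    have "heis_inner (\<gamma> s) (v s) (v s) = (sin (\<phi> s))\<^sup>2 + (cos (\<phi> s))\<^sup>2"
      unfolding heis_inner_def T0 by (simp add: v_def power2_eq_square)
    then show ?thesis by (simp add: heis_norm_def)
  qed
  have v0: "v s \<noteq> 0" for s
    using sin_zero_abs_cos_one[of "\<phi> s"] by (auto simp: v_def zero_prod_def)

  \<comment> \<open>Contact with the lines and the envelope property\<close>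
  have contact: "contacts \<gamma> {0..l} s (?L (\<phi> s))" if "s \<in> {0..l}" for s
  proof -
    have line: "\<gamma> s + r *\<^sub>R v s \<in> ?L (\<phi> s)" for r
      unfolding horizontal_line_def \<gamma>_def v_def x_def y_def z_def
      \<comment> \<open>The point \<open>\<gamma> s\<close> sits at parameter
        \<open>p' (\<phi> s)\<close> of its line, and \<open>v s\<close> is exactly the direction
        vector in \<open>horizontal_line\<close>.\<close>
      by (auto intro!: exI[of _ "p' (\<phi> s) + r"] simp: algebra_simps)
    then show ?thesis
      using line[of 0] v0 by (simp add: contacts_def vel[OF that])
  qed
  have regular: "horizontally_regular \<gamma> {0..l}"
    using C1 v0 by (simp add: horizontally_regular_def vel contact_part_horizontal T0)
  have arclength: "horizontal_arclength_param \<gamma> {0..l}"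
    using C1 norm1 by (simp add: horizontal_arclength_param_def vel contact_part_horizontal T0)
  have envelope: "horizontal_envelope \<gamma> {0..l} (?L ` ?I)"
    unfolding horizontal_envelope_def
  proof (intro conjI ballI)
    show "horizontal_curve \<gamma> {0..l}"
      using C1 by (simp add: horizontal_curve_def vel contact_plane_iff T0)
    show "\<exists>s\<in>{0..l}. contacts \<gamma> {0..l} s L" if L: "L \<in> ?L ` ?I" for L
    proof -
      obtain \<theta> where \<theta>: "\<theta> \<in> ?I" "L = ?L \<theta>" using L by blast
      then show ?thesis
        using contact[OF \<sigma>_in[OF \<theta>(1)]] \<phi>\<sigma>[OF \<theta>(1)] \<sigma>_in[OF \<theta>(1)] by (intro bexI) simp_all
    qed
    show "\<exists>!L. L \<in> ?L ` ?I \<and> contacts \<gamma> {0..l} s L" if s: "s \<in> {0..l}" for s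
    proof (rule ex1I[of _ "?L (\<phi> s)"])
      show "?L (\<phi> s) \<in> ?L ` ?I \<and> contacts \<gamma> {0..l} s (?L (\<phi> s))"
        using contact[OF s] \<phi>_in[OF s] by blast
      \<comment> \<open>Different angles may give the same line, so the argument identifies both
        sets with the tangent line at \<open>s\<close> instead of comparing angles.\<close>
      show "L = ?L (\<phi> s)" if L: "L \<in> ?L ` ?I \<and> contacts \<gamma> {0..l} s L" for L
      proof -
        obtain \<theta> where \<theta>: "L = ?L \<theta>" using L by blast
        show ?thesis
          using L contacts_horizontal_line_eq[of \<gamma> "{0..l}" s "p \<theta>" \<theta> "t \<theta>"]
          unfolding \<theta> contacts_horizontal_line_eq[OF contact[OF s]] by simp
      qed
    qed
  qed

  \<comment> \<open>The p-curvature and the contact normality\<close>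
  have curvature: "has_p_curvature \<gamma> {0..l} (1 / (p \<theta> + p'' \<theta>)) (\<sigma> \<theta>)"
    if p'': "has_C1_deriv_on p' p'' ?I" and \<theta>: "\<theta> \<in> ?I" and nz: "p \<theta> + p'' \<theta> \<noteq> 0" for p'' \<theta>
  proof -
    let ?s = "\<sigma> \<theta>" and ?k = "1 / (p \<theta> + p'' \<theta>)"
    \<comment> \<open>The derivative of \<open>v\<close> by the chain rule, as \<open>\<phi>\<close>
      has derivative \<open>?k\<close>. Since J of the velocity has first two components
      \<open>- cos \<theta>\<close> and \<open>- sin \<theta>\<close>, those of \<open>a\<close> are
      \<open>?k\<close> times them.\<close>
    define a where "a = (- cos \<theta> * ?k, - sin \<theta> * ?k, - (p' \<theta> * ?k))"
    note [simp] = \<phi>\<sigma>[OF \<theta>]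
    have "(p' has_real_derivative p'' \<theta>) (at \<theta> within ?I)"
      using p'' \<theta> by (simp add: has_C1_deriv_on_def)
    from DERIV_add[OF dQ[OF \<theta>] this]
    have "(\<sigma> has_real_derivative p \<theta> + p'' \<theta>) (at \<theta> within ?I)"
      by (simp add: \<sigma>_def[abs_def] add.commute)
    then have "(\<sigma> has_real_derivative p \<theta> + p'' \<theta>) (at (\<phi> ?s) within ?I)"
      by simp
    then have d\<phi>: "(\<phi> has_real_derivative ?k) (at ?s within {0..l})"
      using nz c\<phi> \<phi>_im \<sigma>\<phi> \<sigma>_in[OF \<theta>] by (intro has_real_derivative_right_inverse) auto
    have "((\<lambda>s. p (\<phi> s)) has_real_derivative p' \<theta> * ?k) (at ?s within {0..l})"
      using DERIV_image_chain[of p "p' \<theta>" \<phi> ?s "{0..l}" ?k] dp[OF \<theta>] d\<phi> \<phi>_im by (simp add: o_def)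
    then have "(v has_vector_derivative a) (at ?s within {0..l})"
      unfolding v_def a_def
      by (intro has_vector_derivative_heis) (auto intro!: derivative_eq_intros d\<phi>)
    \<comment> \<open>The velocity is known to equal \<open>v\<close> only on \<open>{0..l}\<close>,
      which suffices for a derivative within that interval.\<close>
    then have acc: "(velocity \<gamma> {0..l} has_vector_derivative a) (at ?s within {0..l})"
      by (rule has_vector_derivative_transform[rotated 2]) (use vel \<sigma>_in[OF \<theta>] in auto)
    have "heis_inner (\<gamma> ?s) a (heis_J (\<gamma> ?s) (v ?s)) =
        cos \<theta> * cos \<theta> * ?k + sin \<theta> * sin \<theta> * ?k"
      using T0[of ?s]
      by (simp add: heis_inner_def heis_J_def \<gamma>_def v_def a_def algebra_simps)
    also have "\<dots> = ?k"
      by (simp flip: distrib_right add_divide_distrib)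
    finally show ?thesis
      unfolding has_p_curvature_def using acc vel[OF \<sigma>_in[OF \<theta>]] by metis
  qed
  have normality: "contact_normality \<gamma> {0..l} s = 0" if "s \<in> {0..l}" for s
    using T0[of s] by (simp add: contact_normality_def vel[OF that] heis_inner_def heis_T_def)

  have "\<gamma> (\<sigma> \<theta>) = (p \<theta> * cos \<theta> - p' \<theta> * sin \<theta>, p \<theta> * sin \<theta> + p' \<theta> * cos \<theta>, t \<theta> - p' \<theta> * p \<theta>)
      \<and> contacts \<gamma> {0..l} (\<sigma> \<theta>) (?L \<theta>)" if "\<theta> \<in> ?I" for \<theta>
    using contact[OF \<sigma>_in[OF that]] by (simp add: \<phi>\<sigma>[OF that] \<gamma>_def x_def y_def z_def)
  then show ?thesis
    using l regular arclength envelope hom curvature normality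
    by (intro exI[of _ l] exI[of _ \<gamma>] exI[of _ \<sigma>] exI[of _ \<phi>]) blast
qed

end
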